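(* Let $n$ and $r$ be positive integers, let $t_1,\ldots,t_r$ be positive integers and put $\sigma=\frac{t_1t_2\cdots t_r}{\max\{t_1,\ldots,t_r\}}$. Suppose $\mathcal{D}$ is a family (set) of $r$-decompositions of $[n]$ such that $\mathcal{D}_k$ is $t_k$-chain free for each $k\in\{1,\ldots,r\}$. Then $$\sum_{a_1+\cdots+a_r=n}\frac{|\mathcal{D}_{a_1,\ldots,a_r}|}{\binom{n}{a_1,\ldots,a_r}}\le\sigma,$$ where the sum is over all $r$-tuples of non-negative integers $(a_1,\ldots,a_r)$ with $a_1+\cdots+a_r=n$. Consequently, $$|\mathcal{D}|\le m_1+\cdots+m_\sigma,$$ where $m_1,\ldots,m_\sigma$ are the $\sigma$ largest multinomial coefficients $\binom{n}{a_1,\ldots,a_r}$ for non-negative integers $a_1,\ldots,a_r$ with $a_1+\cdots+a_r=n$.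
   Context: $[n]=\{1,\ldots,n\}$ and $B(n)$ is the lattice of all subsets of $[n]$ ordered by inclusion. A chain of length $t$ in $B(n)$ is a collection of $t+1$ (distinct) subsets of $[n]$ that are pairwise comparable under inclusion. A family $\mathcal{A}\subseteq B(n)$ is $t$-chain free if it contains no chain of length $t$ (so $1$-chain free means antichain). An $r$-decomposition of $[n]$ is an $r$-tuple $(D_1,\ldots,D_r)$ of pairwise disjoint (possibly empty) subsets of $[n]$ with $\bigcup_{i=1}^r D_i=[n]$. For a family $\mathcal{D}$ of $r$-decompositions, $\mathcal{D}_k=\{D_k\mid (D_1,\ldots,D_k,\ldots,D_r)\in\mathcal{D}\}$ for $k\in\{1,\ldots,r\}$, and for non-negative integers $a_1,\ldots,a_r$ with $a_1+\cdots+a_r=n$, $\mathcal{D}_{a_1,\ldots,a_r}=\{(D_1,\ldots,D_r)\in\mathcal{D}\mid |D_i|=a_i,\ i=1,\ldots,r\}$. $\binom{n}{a_1,\ldots,a_r}=\frac{n!}{a_1!\cdots a_r!}$. The "$\sigma$ largest" coefficients are taken from the list of values indexed by all tuples $(a_1,\ldots,a_r)$, i.e. counted with multiplicity (different tuples giving the same value count separately); if $\sigma$ exceeds the number of such tuples, the missing $m_i$ are set to $0$. *)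

theory Defs
  imports Complex_Main "HOL-Library.Multiset" "HOL-Library.Disjoint_Sets"
begin

text \<open>A chain of length \<open>t\<close> has \<open>t + 1\<close> members.\<close>

definition chain_free :: "nat \<Rightarrow> 'a set set \<Rightarrow> bool" where
  "chain_free t \<A> \<longleftrightarrow> \<not> (\<exists>C \<in> chains \<A>. card C = t + 1)"

text \<open>An \<open>r\<close>-tuple is a list of length \<open>r\<close>, so that coordinate indices run over \<open>0, \<dots>, r - 1\<close>.
  Disjointness is required of the parts at distinct positions; the empty set may occur repeatedly.\<close>

definition decompositions :: "nat \<Rightarrow> nat \<Rightarrow> nat set list set" where
  "decompositions r n =
     {D. length D = r \<and> disjoint_family_on (\<lambda>i. D ! i) {..<r} \<and> (\<Union>i<r. D ! i) = {1..n}}"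

definition component :: "'a set list set \<Rightarrow> nat \<Rightarrow> 'a set set" where
  "component \<D> k = (\<lambda>D. D ! k) ` \<D>"

definition with_sizes :: "'a set list set \<Rightarrow> nat list \<Rightarrow> 'a set list set" where
  "with_sizes \<D> a = {D \<in> \<D>. map card D = a}"

definition size_tuples :: "nat \<Rightarrow> nat \<Rightarrow> nat list set" where
  "size_tuples r n = {a. length a = r \<and> sum_list a = n}"

lemma finite_size_tuples: "finite (size_tuples r n)"
proof -
  have "size_tuples r n \<subseteq> {a. set a \<subseteq> {..n} \<and> length a = r}"
    by (auto simp: size_tuples_def member_le_sum_list)
  then show ?thesis
    by (rule finite_subset) (simp add: finite_lists_length_eq)
qed

definition multinomial :: "nat \<Rightarrow> nat list \<Rightarrow> nat" where
  "multinomial n a = fact n div (\<Prod>k\<leftarrow>a. fact k)"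

text \<open>The natural-number divisions in \<open>multinomial\<close> and \<open>sigma\<close> are exact.\<close>

lemma prod_list_fact_dvd: "(\<Prod>k\<leftarrow>a. fact k) dvd (fact (sum_list a) :: nat)"
proof (induction a)
  case (Cons x a)
  have "fact x * (\<Prod>k\<leftarrow>a. fact k) dvd (fact x * fact (sum_list a) :: nat)"
    using Cons.IH by (rule mult_dvd_mono[OF dvd_refl])
  also have "\<dots> dvd fact (x + sum_list a)"
    by (rule fact_fact_dvd_fact)
  finally show ?case by simp
qed simp

lemma multinomial_exact:
  assumes "a \<in> size_tuples r n"
  shows "multinomial n a * (\<Prod>k\<leftarrow>a. fact k) = fact n"
  using prod_list_fact_dvd[of a] assms
  by (auto simp: multinomial_def size_tuples_def)

definition sigma :: "nat list \<Rightarrow> nat" where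
  "sigma t = prod_list t div Max (set t)"

lemma sigma_exact:
  assumes "t \<noteq> []"
  shows "sigma t * Max (set t) = prod_list t"
proof -
  have "Max (set t) dvd prod_list t"
    using assms by (intro prod_list_dvd) simp
  then show ?thesis by (simp add: sigma_def)
qed

text \<open>Coefficients are counted once per tuple. The list has fewer than \<open>s\<close> entries if there are
  fewer than \<open>s\<close> tuples, which amounts to setting the missing ones to \<open>0\<close> in the sum.\<close>

definition largest_multinomials :: "nat \<Rightarrow> nat \<Rightarrow> nat \<Rightarrow> nat list" where
  "largest_multinomials s r n =
     take s (rev (sorted_list_of_multiset (image_mset (multinomial n) (mset_set (size_tuples r n)))))"

end

theory Submission
  imports Defs "HOL-Combinatorics.Multiset_Permutations"
begin

text \<open>The sets of a \<open>t\<close>-chain free family that are initial segments of a given ordering of \<open>S\<close>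
  form a chain, so there are at most \<open>t\<close> of them; counting orderings gives the LYM inequality with
  constant \<open>t\<close>. Splitting a family of decompositions according to one part and applying this to the
  parts in turn bounds the total weight by a product of the \<open>t\<^sub>k\<close>. The part left at the end costs
  nothing, as it is determined by the others; take it to be one with maximal \<open>t\<^sub>k\<close>.
  The bound on the size follows because a sum of coefficients with weights in \<open>[0, 1]\<close>
  and total weight at most \<open>\<sigma>\<close> is maximal when the \<open>\<sigma>\<close> largest have weight \<open>1\<close>.\<close>

section \<open>Chain-free families\<close>

lemma chain_free_subset:
  assumes "chain_free t \<A>" "\<B> \<subseteq> \<A>"
  shows "chain_free t \<B>"
  using assms unfolding chain_free_def chains_def by blast

lemma chain_free_card_le:
  assumes "chain_free t \<A>" "C \<in> chains \<A>"
  shows "card C \<le> t"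
proof (rule ccontr)
  assume "\<not> card C \<le> t"
  then obtain C' where "C' \<subseteq> C" "card C' = t + 1"
    using obtain_subset_with_card_n[of "t + 1" C] by auto
  moreover from this assms(2) have "C' \<in> chains \<A>"
    unfolding chains_def chain_subset_def by blast
  ultimately show False using assms(1)
    unfolding chain_free_def by blast
qed

lemma chain_free_1_if_card_eq:
  assumes "\<And>A. A \<in> \<A> \<Longrightarrow> finite A \<and> card A = c"
  shows "chain_free 1 \<A>"
  unfolding chain_free_def
proof
  assume "\<exists>C\<in>chains \<A>. card C = 1 + 1"
  then obtain A B where "A \<noteq> B" "{A, B} \<in> chains \<A>"
    by (metis card_2_iff one_add_one)
  then show False
    using assms by (auto simp: chains_def chain_subset_def dest: card_subset_eq)
qed

section \<open>Orderings of a set and the LYM inequality\<close>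

lemma card_permutations_with_prefix_set:
  assumes "finite S" "A \<subseteq> S"
  shows "card {xs \<in> permutations_of_set S. set (take (card A) xs) = A} =
         fact (card A) * fact (card (S - A))"
proof -
  let ?P = "permutations_of_set A \<times> permutations_of_set (S - A)"
  have fin: "finite A" using assms finite_subset by blast
  \<comment> \<open>An ordering of \<open>S\<close> that begins with the elements of
    \<open>A\<close> is an ordering of \<open>A\<close> followed by one of
    \<open>S - A\<close>.\<close>
  have "{xs \<in> permutations_of_set S. set (take (card A) xs) = A} = (\<lambda>(ys, zs). ys @ zs) ` ?P"
    (is "?L = ?R")
  proof
    show "?L \<subseteq> ?R"
    proof
      fix xs assume "xs \<in> ?L"
      then have xs: "set xs = S" "distinct xs" "set (take (card A) xs) = A"
        by (auto simp: permutations_of_set_def)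
      let ?k = "card A"
      have "set (drop ?k xs) = S - A"
        using xs set_take_disj_set_drop_if_distinct[of xs ?k ?k] set_append[of "take ?k xs" "drop ?k xs"]
        by auto
      then have "(take ?k xs, drop ?k xs) \<in> ?P"
        using xs by (auto simp: permutations_of_set_def)
      then show "xs \<in> ?R" by (rule rev_image_eqI) simp
    qed
    have "set (take (card A) (ys @ zs)) = A" if "set ys = A" "distinct ys" for ys zs
      using that distinct_card[of ys] by simp
    then show "?R \<subseteq> ?L"
      using assms(2) by (auto simp: permutations_of_set_def)
  qed
  \<comment> \<open>The first block always has length \<open>card A\<close>, so a concatenation
    determines both blocks.\<close>
  moreover have "inj_on (\<lambda>(ys, zs). ys @ zs) ?P"
  proof -
    have "length ys = card A" if "ys \<in> permutations_of_set A" for ys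
      using that by (auto simp: permutations_of_set_def distinct_card)
    then show ?thesis by (auto simp: inj_on_def)
  qed
  ultimately show ?thesis
    using assms fin by (simp add: card_image card_cartesian_product)
qed

text \<open>The factor \<open>fact (card S)\<close> keeps the inequality in the natural numbers: the
  term of \<open>A\<close> is the number of orderings of \<open>S\<close> that begin with
  \<open>A\<close>, and such pairs are counted in two ways.\<close>

lemma LYM_chain_free:
  assumes "finite S" "\<A> \<subseteq> Pow S" "chain_free t \<A>"
  shows "(\<Sum>A\<in>\<A>. fact (card A) * fact (card (S - A))) \<le> t * (fact (card S) :: nat)"
proof -
  let ?P = "permutations_of_set S"
  let ?R = "\<lambda>A xs. set (take (card A) xs) = A"
  have fin: "finite \<A>" using assms by (meson finite_Pow_iff finite_subset)
  have "(\<Sum>A\<in>\<A>. fact (card A) * fact (card (S - A))) = (\<Sum>A\<in>\<A>. card {xs \<in> ?P. ?R A xs})"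
    using assms by (intro sum.cong refl card_permutations_with_prefix_set[symmetric]) auto
  also have "\<dots> = (\<Sum>xs\<in>?P. card {A \<in> \<A>. ?R A xs})"
    using fin by (intro sum_multicount_gen) auto
  also have "\<dots> \<le> (\<Sum>xs\<in>?P. t)"
  proof (rule sum_mono)
    fix xs
    \<comment> \<open>Of two initial segments of \<open>xs\<close>, the shorter lies in the
      longer.\<close>
    have "{A \<in> \<A>. ?R A xs} \<in> chains \<A>"
      unfolding chains_def chain_subset_def
      by (auto, metis nat_le_linear set_take_subset_set_take subsetD)
    then show "card {A \<in> \<A>. ?R A xs} \<le> t"
      by (rule chain_free_card_le[OF assms(3)])
  qed
  also have "\<dots> = t * fact (card S)" using assms by simp
  finally show ?thesis .
qed

section \<open>Weights of decompositions\<close>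

text \<open>The elements of \<open>F\<close> are kept abstract, so that the induction can forget a part without
  changing \<open>F\<close>; \<open>inj\<close> says that they are determined by the parts still in play.\<close>

lemma decomposition_weight_le:
  fixes p :: "'d \<Rightarrow> 'i \<Rightarrow> 'a set" and t :: "'i \<Rightarrow> nat"
  assumes "finite I" "m \<notin> I" "finite S" "finite F"
    and part: "\<And>D. D \<in> F \<Longrightarrow> disjoint_family_on (p D) (insert m I) \<and> (\<Union>i\<in>insert m I. p D i) = S"
    and inj: "\<And>D E. D \<in> F \<Longrightarrow> E \<in> F \<Longrightarrow> (\<forall>i\<in>insert m I. p D i = p E i) \<Longrightarrow> D = E"
    and cf: "\<And>k. k \<in> I \<Longrightarrow> chain_free (t k) ((\<lambda>D. p D k) ` F)"
  shows "(\<Sum>D\<in>F. \<Prod>i\<in>insert m I. fact (card (p D i))) \<le> (\<Prod>i\<in>I. t i) * (fact (card S) :: nat)"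
  using assms
proof (induction I arbitrary: S F rule: finite_induct)
  case empty
  \<comment> \<open>With one part left, that part is all of \<open>S\<close>, so \<open>inj\<close>
    allows at most one element in \<open>F\<close>.\<close>
  have S: "p D m = S" if "D \<in> F" for D
    using empty.prems(4)[OF that] by simp
  have "E = D" if "D \<in> F" "E \<in> F" for D E
    by (rule empty.prems(5)) (simp_all add: that S)
  then have "F = {D}" if "D \<in> F" for D
    using that by blast
  then have "F = {} \<or> (\<exists>D. F = {D} \<and> p D m = S)"
    using S by blast
  then show ?case by auto
next
  case (insert k I)
  let ?J = "insert m I"
  let ?\<A> = "(\<lambda>D. p D k) ` F"
  let ?G = "\<lambda>A. {D \<in> F. p D k = A}"
  let ?w = "\<lambda>D. \<Prod>i\<in>?J. fact (card (p D i)) :: nat"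
  have k: "k \<notin> ?J" and m: "m \<notin> I" using insert by auto
  have J: "insert m (insert k I) = insert k ?J" by auto
  have sub: "?\<A> \<subseteq> Pow S" using insert.prems(4) by fastforce
  \<comment> \<open>Once the part at \<open>k\<close> is fixed as \<open>A\<close>, the other parts
    decompose \<open>S - A\<close> and still determine \<open>D\<close>, so the induction hypothesis
    applies to the fibre.\<close>
  have G: "(\<Sum>D\<in>?G A. ?w D) \<le> (\<Prod>i\<in>I. t i) * fact (card (S - A))" for A
  proof (rule insert.IH)
    fix D assume D: "D \<in> ?G A"
    then have dis: "disjoint_family_on (p D) (insert k ?J)"
      and un: "(\<Union>i\<in>insert k ?J. p D i) = S" and A: "p D k = A"
      using insert.prems(4)[of D] J by auto
    have "p D i \<inter> A = {}" if "i \<in> ?J" for i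
      using dis k that A unfolding disjoint_family_on_def by (metis insertCI)
    then have "(\<Union>i\<in>?J. p D i) = S - A" using un A by auto
    moreover have "disjoint_family_on (p D) ?J"
      using dis by (rule disjoint_family_on_mono[rotated]) auto
    ultimately show "disjoint_family_on (p D) ?J \<and> (\<Union>i\<in>?J. p D i) = S - A" by simp
  next
    fix D E assume "D \<in> ?G A" "E \<in> ?G A" "\<forall>i\<in>?J. p D i = p E i"
    then show "D = E" by (intro insert.prems(5)) auto
  next
    fix j assume "j \<in> I"
    then show "chain_free (t j) ((\<lambda>D. p D j) ` ?G A)"
      by (intro chain_free_subset[OF insert.prems(6)]) auto
  qed (simp_all add: m insert.prems(2,3))
  have "(\<Sum>D\<in>F. \<Prod>i\<in>insert m (insert k I). fact (card (p D i)))
      = (\<Sum>D\<in>F. fact (card (p D k)) * ?w D)"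
    unfolding J using k insert.hyps by simp
  also have "\<dots> = (\<Sum>A\<in>?\<A>. \<Sum>D\<in>?G A. fact (card (p D k)) * ?w D)"
    using insert.prems by (intro sum.image_gen)
  also have "\<dots> = (\<Sum>A\<in>?\<A>. fact (card A) * (\<Sum>D\<in>?G A. ?w D))"
    by (simp add: sum_distrib_left)
  also have "\<dots> \<le> (\<Sum>A\<in>?\<A>. fact (card A) * ((\<Prod>i\<in>I. t i) * fact (card (S - A))))"
    by (intro sum_mono mult_left_mono G) auto
  also have "\<dots> = (\<Prod>i\<in>I. t i) * (\<Sum>A\<in>?\<A>. fact (card A) * fact (card (S - A)))"
    by (simp add: sum_distrib_left mult_ac)
  \<comment> \<open>What remains is the LYM sum of the family of parts at \<open>k\<close>, which is
    \<open>t k\<close>-chain free.\<close>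
  also have "\<dots> \<le> (\<Prod>i\<in>I. t i) * (t k * fact (card S))"
    using sub insert.prems by (intro mult_left_mono LYM_chain_free) auto
  also have "\<dots> = (\<Prod>i\<in>insert k I. t i) * fact (card S)"
    using insert.hyps by simp
  finally show ?case .
qed

section \<open>Sums with bounded weights\<close>

lemma weighted_sum_le_sum_largest:
  fixes M :: "'a \<Rightarrow> nat" and x :: "'a \<Rightarrow> real"
  assumes "finite T" and x: "\<And>a. a \<in> T \<Longrightarrow> 0 \<le> x a \<and> x a \<le> 1" and "(\<Sum>a\<in>T. x a) \<le> real s"
  shows "(\<Sum>a\<in>T. x a * M a)
    \<le> sum_list (take s (rev (sorted_list_of_multiset (image_mset M (mset_set T)))))"
proof -
  obtain bs where bs: "set bs = T" "distinct bs"
    using assms(1) finite_distinct_list by blast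
  \<comment> \<open>Descending order, so that the first \<open>s\<close> positions, later
    \<open>U\<close>, carry the largest values.\<close>
  define as where "as = rev (sort_key M bs)"
  have as: "set as = T" "distinct as" "sorted (map M (rev as))"
    using bs by (auto simp: as_def)
  have "mset_set T = mset (rev as)"
    using as mset_set_set by fastforce
  then have "image_mset M (mset_set T) = mset (map M (rev as))" by simp
  then have srt: "sorted_list_of_multiset (image_mset M (mset_set T)) = map M (rev as)"
    using as(3) by (simp only: sorted_list_of_multiset_mset sorted_sort_id)
  define U where "U = set (take s as)"
  define V where "V = set (drop s as)"
  have UV: "T = U \<union> V" "U \<inter> V = {}" "finite U" "finite V"
    using as set_take_disj_set_drop_if_distinct[of as s s] set_append[of "take s as" "drop s as"]
    by (auto simp: U_def V_def)
  have "sum_list (take s (map M as)) = (\<Sum>a\<in>U. M a)"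
    unfolding U_def take_map using as by (simp add: sum_list_distinct_conv_sum_set)
  moreover have "(\<Sum>a\<in>T. x a * M a) \<le> (\<Sum>a\<in>U. real (M a))"
  proof (cases "V = {}")
    \<comment> \<open>There are at most \<open>s\<close> elements, and raising every weight to 1
      suffices.\<close>
    case True
    then show ?thesis
      using UV x by (auto intro!: sum_mono mult_left_le_one_le)
  next
    case False
    then have len: "s < length as" by (auto simp: V_def not_less)
    then have cU: "card U = s" using as by (simp add: U_def distinct_card)
    \<comment> \<open>Positions count from 0, so \<open>s\<close> is the first one after
      \<open>U\<close>; its value separates those on \<open>U\<close> from those on
      \<open>V\<close>.\<close>
    define v where "v = M (as ! s)"
    have desc: "M (as ! j) \<le> M (as ! i)" if "i \<le> j" "j < length as" for i j
    proof -
      have "sorted_wrt (\<ge>) (map M as)" using as(3) by (simp flip: rev_map add: sorted_wrt_rev)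
      then show ?thesis
        using that by (cases "i = j") (auto simp: sorted_wrt_iff_nth_less)
    qed
    have U: "v \<le> M a" if "a \<in> U" for a
      using that len desc[of _ s] unfolding U_def v_def by (auto simp: in_set_conv_nth)
    have V: "M a \<le> v" if "a \<in> V" for a
      using that len desc[of s] unfolding V_def v_def by (auto simp: in_set_conv_nth)
    \<comment> \<open>After subtracting \<open>v\<close>, terms are nonnegative on \<open>U\<close>
      and nonpositive on \<open>V\<close>, so weights 1 and 0 there only increase the sum. The shift
      costs at most \<open>v * s\<close>, which cancels because \<open>card U = s\<close>.\<close>
    have "(\<Sum>a\<in>T. x a * M a) = (\<Sum>a\<in>T. x a * (real (M a) - v)) + v * (\<Sum>a\<in>T. x a)"
      by (simp add: algebra_simps sum_subtractf sum_distrib_left)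
    also have "(\<Sum>a\<in>T. x a * (real (M a) - v))
        = (\<Sum>a\<in>U. x a * (real (M a) - v)) + (\<Sum>a\<in>V. x a * (real (M a) - v))"
      using UV by (simp add: sum.union_disjoint)
    also have "\<dots> \<le> (\<Sum>a\<in>U. real (M a) - v) + 0"
      using U V x UV(1)
      by (intro add_mono sum_mono mult_left_le_one_le sum_nonpos mult_nonneg_nonpos) auto
    also have "v * (\<Sum>a\<in>T. x a) \<le> v * real s"
      by (intro mult_left_mono assms) auto
    finally show ?thesis by (simp add: sum_subtractf cU mult.commute)
  qed
  ultimately show ?thesis by (simp add: srt rev_map)
qed

section \<open>Decompositions of \<open>{1..n}\<close> and multinomial coefficients\<close>

lemma finite_decompositions: "finite (decompositions r n)"
proof (rule finite_subset)
  show "decompositions r n \<subseteq> {D. set D \<subseteq> Pow {1..n} \<and> length D = r}"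
    by (force simp: decompositions_def in_set_conv_nth)
qed (simp add: finite_lists_length_eq)

lemma map_card_in_size_tuples:
  assumes "D \<in> decompositions r n"
  shows "map card D \<in> size_tuples r n"
proof -
  have D: "length D = r" "disjoint_family_on (\<lambda>i. D ! i) {..<r}" "(\<Union>i<r. D ! i) = {1..n}"
    using assms by (auto simp: decompositions_def)
  have "finite (D ! i)" if "i < r" for i
    using D(3) that by (metis UN_upper finite_atLeastAtMost finite_subset lessThan_iff)
  then have "card (\<Union>i<r. D ! i) = (\<Sum>i<r. card (D ! i))"
    using D(2) by (intro card_UN_disjoint) (auto simp: disjoint_family_on_def)
  then show ?thesis
    using D by (simp add: size_tuples_def sum_list_sum_nth atLeast0LessThan)
qed

lemma prod_list_fact_map_card:
  "(\<Prod>k\<leftarrow>map card D. fact k) = (\<Prod>i<length D. fact (card (D ! i)))"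
  by (simp add: prod.list_conv_set_nth atLeast0LessThan)

text \<open>Divided by \<open>fact n\<close>, the summand of \<open>D\<close> is the reciprocal of
  the multinomial coefficient of its part sizes. With \<open>m\<close> and the function
  \<open>t\<close> arbitrary, this serves both the given bounds and the constant 1.\<close>

lemma decompositions_weight_le:
  assumes "\<D> \<subseteq> decompositions r n" "m < r"
    and "\<And>k. k < r \<Longrightarrow> k \<noteq> m \<Longrightarrow> chain_free (t k) (component \<D> k)"
  shows "(\<Sum>D\<in>\<D>. \<Prod>k\<leftarrow>map card D. fact k) \<le> (\<Prod>i\<in>{..<r} - {m}. t i) * (fact n :: nat)"
proof -
  have I: "insert m ({..<r} - {m}) = {..<r}" using assms(2) by auto
  have "(\<Sum>D\<in>\<D>. \<Prod>k\<leftarrow>map card D. fact k)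
      = (\<Sum>D\<in>\<D>. \<Prod>i\<in>insert m ({..<r} - {m}). fact (card (D ! i)))"
    unfolding I using assms(1) by (intro sum.cong) (auto simp: prod_list_fact_map_card decompositions_def simp del: map_map)
  also have "\<dots> \<le> (\<Prod>i\<in>{..<r} - {m}. t i) * fact (card {1..n})"
  proof (rule decomposition_weight_le)
    show "finite \<D>" using assms(1) finite_decompositions finite_subset by blast
  next
    fix D assume "D \<in> \<D>"
    then show "disjoint_family_on ((!) D) (insert m ({..<r} - {m}))
        \<and> \<Union> ((!) D ` insert m ({..<r} - {m})) = {1..n}"
      unfolding I using assms(1) by (auto simp: decompositions_def)
  next
    fix D E assume "D \<in> \<D>" "E \<in> \<D>" "\<forall>i\<in>insert m ({..<r} - {m}). D ! i = E ! i"
    moreover from this have "length D = r" "length E = r"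
      using assms(1) by (auto simp: decompositions_def)
    ultimately show "D = E"
      unfolding I by (intro nth_equalityI) auto
  next
    fix k assume "k \<in> {..<r} - {m}"
    then show "chain_free (t k) ((\<lambda>D. D ! k) ` \<D>)"
      using assms(3) by (auto simp: component_def)
  qed auto
  finally show ?thesis by simp
qed

text \<open>For a size tuple \<open>a\<close>, \<open>multinomial_exact\<close> makes the right-hand
  side \<open>fact n\<close> times the term of \<open>a\<close> in the LYM sum.\<close>

lemma with_sizes_weight:
  "(\<Sum>D\<in>with_sizes \<D> a. \<Prod>k\<leftarrow>map card D. fact k) = card (with_sizes \<D> a) * (\<Prod>k\<leftarrow>a. fact k :: nat)"
proof -
  have "(\<Sum>D\<in>with_sizes \<D> a. \<Prod>k\<leftarrow>map card D. fact k) = (\<Sum>D\<in>with_sizes \<D> a. \<Prod>k\<leftarrow>a. fact k :: nat)"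
    by (intro sum.cong) (auto simp: with_sizes_def simp del: map_map)
  then show ?thesis by simp
qed

lemma multinomial_pos:
  assumes "a \<in> size_tuples r n"
  shows "multinomial n a > 0"
  using multinomial_exact[OF assms] by (metis fact_nonzero gr0I mult_zero_left)

text \<open>Sets of equal size form an antichain, so this is the weight bound with all \<open>t\<^sub>k = 1\<close>.\<close>

lemma card_with_sizes_le_multinomial:
  assumes "\<D> \<subseteq> decompositions r n" "r > 0" "a \<in> size_tuples r n"
  shows "card (with_sizes \<D> a) \<le> multinomial n a"
proof -
  have sub: "with_sizes \<D> a \<subseteq> decompositions r n" using assms(1) by (auto simp: with_sizes_def)
  have "chain_free 1 (component (with_sizes \<D> a) k)" if "k < r" for k
  proof (rule chain_free_1_if_card_eq)
    fix A assume "A \<in> component (with_sizes \<D> a) k"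
    then obtain D where D: "D \<in> decompositions r n" "map card D = a" "A = D ! k"
      using sub by (auto simp: component_def with_sizes_def)
    then have "A \<subseteq> {1..n}" "length D = r" using that by (auto simp: decompositions_def)
    then show "finite A \<and> card A = a ! k"
      using D that by (auto intro: finite_subset)
  qed
  \<comment> \<open>Any part may be left out here; position 0 exists because
    \<open>r > 0\<close>.\<close>
  then have "(\<Sum>D\<in>with_sizes \<D> a. \<Prod>k\<leftarrow>map card D. fact k) \<le> (\<Prod>i\<in>{..<r} - {0}. 1) * (fact n :: nat)"
    using assms(2) by (intro decompositions_weight_le[OF sub]) auto
  then have "card (with_sizes \<D> a) * (\<Prod>k\<leftarrow>a. fact k) \<le> multinomial n a * (\<Prod>k\<leftarrow>a. fact k)"
    by (simp add: with_sizes_weight multinomial_exact[OF assms(3)] del: map_map)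
  moreover have "(\<Prod>k\<leftarrow>a. fact k :: nat) > 0"
    using multinomial_exact[OF assms(3)] by (metis fact_nonzero gr0I mult_zero_right)
  ultimately show ?thesis by simp
qed

lemma sum_with_sizes:
  assumes "\<D> \<subseteq> decompositions r n"
  shows "(\<Sum>a\<in>size_tuples r n. \<Sum>D\<in>with_sizes \<D> a. f D) = (\<Sum>D\<in>\<D>. f D)"
  unfolding with_sizes_def
  using assms finite_decompositions finite_subset map_card_in_size_tuples
  by (intro sum.group finite_size_tuples) blast+

text \<open>Only the single position \<open>m\<close> is left out, so ties for the maximum do no
  harm; positivity lets the division cancel.\<close>

lemma sigma_eq_prod:
  assumes "length t = r" "m < r" "t ! m = Max (set t)" "t ! m > 0"
  shows "sigma t = (\<Prod>i\<in>{..<r} - {m}. t ! i)"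
proof -
  have "prod_list t = (\<Prod>i<r. t ! i)"
    using assms(1) by (simp add: prod.list_conv_set_nth atLeast0LessThan)
  also have "\<dots> = Max (set t) * (\<Prod>i\<in>{..<r} - {m}. t ! i)"
    using assms(2,3) by (simp add: prod.remove[of "{..<r}" m])
  finally show ?thesis using assms(3,4) by (simp add: sigma_def)
qed

theorem theorem3p1:
  fixes n r :: nat and t :: "nat list" and \<D> :: "nat set list set"
  assumes "n > 0" and "r > 0"
    and "length t = r" and "\<forall>k<r. t ! k > 0"
    and "\<D> \<subseteq> decompositions r n"
    and "\<forall>k<r. chain_free (t ! k) (component \<D> k)"
  shows "(\<Sum>a\<in>size_tuples r n. real (card (with_sizes \<D> a)) / real (multinomial n a))
           \<le> real (sigma t)
       \<and> card \<D> \<le> sum_list (largest_multinomials (sigma t) r n)"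
proof -
  let ?x = "\<lambda>a. real (card (with_sizes \<D> a)) / real (multinomial n a)"
  have "Max (set t) \<in> set t" using assms(2,3) by (intro Max_in) auto
  then obtain m where m: "m < r" "t ! m = Max (set t)"
    using assms(3) by (auto simp: in_set_conv_nth)
  \<comment> \<open>Multiplied by \<open>fact n\<close>, the LYM sum becomes the total weight of
    \<open>\<D>\<close>; the part left out is \<open>m\<close>, where \<open>t\<close> is
    maximal.\<close>
  have "(\<Sum>a\<in>size_tuples r n. card (with_sizes \<D> a) * (\<Prod>k\<leftarrow>a. fact k))
      = (\<Sum>D\<in>\<D>. \<Prod>k\<leftarrow>map card D. fact k)"
    by (simp only: with_sizes_weight[symmetric] sum_with_sizes[OF assms(5)])
  also have "\<dots> \<le> sigma t * fact n"
    using decompositions_weight_le[OF assms(5) m(1), of "(!) t"] assms(6)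
      sigma_eq_prod[OF assms(3) m] m(1) assms(4) by simp
  finally have w: "(\<Sum>a\<in>size_tuples r n. card (with_sizes \<D> a) * (\<Prod>k\<leftarrow>a. fact k)) \<le> sigma t * fact n" .
  have x: "?x a * fact n = real (card (with_sizes \<D> a) * (\<Prod>k\<leftarrow>a. fact k))"
    if "a \<in> size_tuples r n" for a
  proof -
    have "fact n = real (multinomial n a) * real (\<Prod>k\<leftarrow>a. fact k)"
      using multinomial_exact[OF that] by (metis of_nat_fact of_nat_mult)
    then show ?thesis using multinomial_pos[OF that] by simp
  qed
  have "(\<Sum>a\<in>size_tuples r n. ?x a) * fact n
      = real (\<Sum>a\<in>size_tuples r n. card (with_sizes \<D> a) * (\<Prod>k\<leftarrow>a. fact k))"
    unfolding sum_distrib_right of_nat_sum by (intro sum.cong refl x)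
  also have "\<dots> \<le> real (sigma t) * fact n"
    using of_nat_mono[OF w, where 'a = real] by (simp only: of_nat_mult of_nat_fact)
  finally have lym: "(\<Sum>a\<in>size_tuples r n. ?x a) \<le> real (sigma t)" by simp
  have "real (card \<D>) = (\<Sum>a\<in>size_tuples r n. real (card (with_sizes \<D> a)))"
    using sum_with_sizes[OF assms(5), of "\<lambda>_. 1 :: real"] by simp
  \<comment> \<open>The ratios \<open>?x a\<close> now act as weights on the coefficients: each is
    at most 1 by \<open>card_with_sizes_le_multinomial\<close>, and by \<open>lym\<close> their
    total is at most \<open>sigma t\<close>.\<close>
  also have "\<dots> = (\<Sum>a\<in>size_tuples r n. ?x a * multinomial n a)"
    using multinomial_pos by (intro sum.cong) force+
  also have "\<dots> \<le> sum_list (largest_multinomials (sigma t) r n)"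
    unfolding largest_multinomials_def
    using card_with_sizes_le_multinomial[OF assms(5,2)] multinomial_pos lym
    by (intro weighted_sum_le_sum_largest finite_size_tuples) (auto simp: divide_le_eq_1)
  finally show ?thesis using lym by simp
qed

end
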